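(* For every positive integer $g$ there exists $\varepsilon_g>0$ such that $b_\infty^{(g)}\le \frac{2-\varepsilon_g}{g}$.
   Context: A set $\mathcal{A}$ of integers is a $g$-thin Sidon set if for every integer $d$, the number of pairs $(a,b)\in\mathcal{A}^2$ with $a\ne b$ and $a-b=d$ is at most $g$. For a finite set $\mathcal{A}$, $\operatorname{diam}(\mathcal{A})=\max\mathcal{A}-\min\mathcal{A}$. For each $k\ge1$ let $\mathcal{A}_k^{(g)}$ be a $g$-thin Sidon set with $k$ elements and the minimum possible diameter among such sets, and define \[ b_\infty^{(g)}=\limsup_{k\to\infty}\frac{k^2/g-\operatorname{diam}(\mathcal{A}_k^{(g)})}{k^{3/2}}. \] *)

theory Defs
  imports Complex_Main "HOL-Library.Extended_Real"
begin

text \<open>The finiteness conjunct is needed because \<^const>\<open>card\<close> sends infinite sets to \<open>0\<close>.\<close>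

definition thin_sidon :: "nat \<Rightarrow> int set \<Rightarrow> bool" where
  "thin_sidon g A \<longleftrightarrow>
    (\<forall>d. finite {(a, b). a \<in> A \<and> b \<in> A \<and> a \<noteq> b \<and> a - b = d} \<and>
         card {(a, b). a \<in> A \<and> b \<in> A \<and> a \<noteq> b \<and> a - b = d} \<le> g)"

definition diam :: "int set \<Rightarrow> int" where
  "diam A = Max A - Min A"

definition opt_thin_sidon :: "nat \<Rightarrow> nat \<Rightarrow> int set" where
  "opt_thin_sidon g k = (ARG_MIN diam A. finite A \<and> card A = k \<and> thin_sidon g A)"

text \<open>The upper limit is taken in the extended reals, so that no boundedness is presupposed.\<close>

definition b_inf :: "nat \<Rightarrow> ereal" where
  "b_inf g = limsup (\<lambda>k. ereal
    (((real k)\<^sup>2 / real g - real_of_int (diam (opt_thin_sidon g k))) / real k powr (3/2)))"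

text \<open>The minimum defining \<^const>\<open>opt_thin_sidon\<close> is attained for \<open>g \<ge> 1\<close> and \<open>k \<ge> 1\<close>.\<close>

lemma finite_sidon_exists:
  "\<exists>A::int set. finite A \<and> card A = k \<and> (\<forall>a\<in>A. 0 \<le> a) \<and>
     (\<forall>a\<in>A. \<forall>b\<in>A. \<forall>c\<in>A. \<forall>d\<in>A. a \<noteq> b \<longrightarrow> a - b = c - d \<longrightarrow> a = c \<and> b = d)"
proof (induction k)
  case 0
  show ?case by (rule exI[of _ "{}"]) simp
next
  case (Suc k)
  then obtain A :: "int set" where A: "finite A" "card A = k" "\<forall>a\<in>A. 0 \<le> a"
    and S: "\<And>a b c d. a \<in> A \<Longrightarrow> b \<in> A \<Longrightarrow> c \<in> A \<Longrightarrow> d \<in> A \<Longrightarrow> a \<noteq> b \<Longrightarrow>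
      a - b = c - d \<Longrightarrow> a = c \<and> b = d"
    by blast
  define M where "M = Max (insert 0 A)"
  define n where "n = 2 * M + 1"
  have M: "a \<le> M" "0 \<le> a" if "a \<in> A" for a
    using A that unfolding M_def by auto
  have M0: "0 \<le> M" using A(1) unfolding M_def by simp
  have n: "n \<notin> A" using M M0 unfolding n_def by force
  have sidon: "a = c \<and> b = d"
    if "a \<in> insert n A" "b \<in> insert n A" "c \<in> insert n A" "d \<in> insert n A"
      and ne: "a \<noteq> b" and e: "a - b = c - d" for a b c d
  proof -
    have B: "x = n \<or> (x \<in> A \<and> 0 \<le> x \<and> x \<le> M)" if "x \<in> insert n A" for x
      using that M by blast
    show ?thesis
      using B[OF that(1)] B[OF that(2)] B[OF that(3)] B[OF that(4)] ne e M0 S[of a b c d]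
      n_def by (smt (verit))
  qed
  have "finite (insert n A)" "card (insert n A) = Suc k" "\<forall>a\<in>insert n A. 0 \<le> a"
    using A n M0 unfolding n_def by auto
  with sidon show ?case by blast
qed

lemma thin_sidon_exists:
  assumes "g \<ge> 1"
  shows "\<exists>A. finite A \<and> card A = k \<and> thin_sidon g A"
proof -
  obtain A :: "int set" where A: "finite A" "card A = k"
    and S: "\<And>a b c d. a \<in> A \<Longrightarrow> b \<in> A \<Longrightarrow> c \<in> A \<Longrightarrow> d \<in> A \<Longrightarrow> a \<noteq> b \<Longrightarrow>
      a - b = c - d \<Longrightarrow> a = c \<and> b = d"
    using finite_sidon_exists[of k] by blast
  have "finite {(a, b). a \<in> A \<and> b \<in> A \<and> a \<noteq> b \<and> a - b = d} \<and>
        card {(a, b). a \<in> A \<and> b \<in> A \<and> a \<noteq> b \<and> a - b = d} \<le> g" (is "finite ?P \<and> _") for d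
  proof
    show fin: "finite ?P"
      by (rule finite_subset[of _ "A \<times> A"]) (use A in auto)
    have "x = y" if "x \<in> ?P" "y \<in> ?P" for x y
    proof (cases x; cases y)
      fix a b c e assume "x = (a, b)" "y = (c, e)"
      with that S[of a b c e] show "x = y" by auto
    qed
    then have "card ?P \<le> 1"
      using card_le_Suc0_iff_eq[OF fin] by simp
    with assms show "card ?P \<le> g" by simp
  qed
  with A show ?thesis unfolding thin_sidon_def by blast
qed

lemma opt_thin_sidon_is_arg_min:
  assumes "g \<ge> 1" and "k \<ge> 1"
  shows "is_arg_min diam (\<lambda>A. finite A \<and> card A = k \<and> thin_sidon g A) (opt_thin_sidon g k)"
proof -
  let ?P = "\<lambda>A. finite A \<and> card A = k \<and> thin_sidon g A"
  have nonneg: "0 \<le> diam A" if "?P A" for A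
  proof -
    have "A \<noteq> {}" using that assms(2) by auto
    then show ?thesis using that unfolding diam_def by simp
  qed
  obtain A where A: "?P A" "\<And>B. ?P B \<Longrightarrow> nat (diam A) \<le> nat (diam B)"
    using ex_has_least_nat[of ?P _ "\<lambda>A. nat (diam A)"] thin_sidon_exists[OF assms(1), of k]
    by metis
  have "is_arg_min diam ?P A"
    unfolding is_arg_min_linorder
  proof (intro conjI allI impI)
    fix B assume B: "?P B"
    show "diam A \<le> diam B" using A(2)[OF B] nonneg[OF B] by linarith
  qed (use A(1) in blast)+
  then show ?thesis
    unfolding opt_thin_sidon_def arg_min_def by (rule someI)
qed

end

theory Submission
  imports Defs
begin

text \<open>
  Let \<open>A\<close> be a \<open>g\<close>-thin Sidon set with \<open>k\<close> elements and diameter \<open>n\<close>, and slide windows of lengths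
  \<open>h\<close> and \<open>2 h\<close> over it, with \<open>h\<close> about \<open>k powr (3/2) / (2 g)\<close>. The Erdos-Turan second moment
  count bounds the variation of the window counts around their typical values \<open>sqrt k / 2\<close> and
  \<open>sqrt k\<close>. If \<open>n\<close> were as small as \<open>k\<^sup>2 / g - (2 - \<epsilon>) k powr (3/2) / g\<close>, then the counts for
  length \<open>2 h\<close> would be almost constant, even for the windows that stick out of the hull of \<open>A\<close>.
  A window of length \<open>2 h\<close> that sticks out by at least \<open>h\<close> has the same count as a window of
  length \<open>h\<close>, so at both ends of \<open>A\<close> there are \<open>h\<close> windows of length \<open>h\<close> that contain about
  \<open>sqrt k\<close> instead of \<open>sqrt k / 2\<close> points. Their contribution is twice the total variation
  available for length \<open>h\<close>.
\<close>

text \<open>Counting by offsets rather than as a cardinality lets a squared count expand into a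
  double sum over pairs of offsets.\<close>

definition window_count :: "int set \<Rightarrow> int \<Rightarrow> int \<Rightarrow> real" where
  "window_count A h w = (\<Sum>i\<in>{0..<h}. of_bool (w + i \<in> A))"

lemma window_count_add:
  assumes "0 \<le> h" "0 \<le> l"
  shows "window_count A (h + l) w = window_count A h w + window_count A l (w + h)"
proof -
  have "{0..<h + l} = {0..<h} \<union> {h..<h + l}"
    using assms by auto
  moreover have "{0..<h} \<inter> {h..<h + l} = {}"
    by auto
  ultimately have "window_count A (h + l) w
      = window_count A h w + (\<Sum>i\<in>{h..<h + l}. of_bool (w + i \<in> A))"
    unfolding window_count_def by (simp only: sum.union_disjoint finite_atLeastLessThan_int)
  also have "(\<Sum>i\<in>{h..<h + l}. of_bool (w + i \<in> A)) = window_count A l (w + h)"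
    unfolding window_count_def
    by (rule sum.reindex_bij_witness[of _ "\<lambda>i. i + h" "\<lambda>i. i - h"]) (auto simp: add_ac)
  finally show ?thesis .
qed

lemma window_count_eq_0:
  assumes "\<And>a. a \<in> A \<Longrightarrow> w \<le> a \<Longrightarrow> a < w + h \<Longrightarrow> False"
  shows "window_count A h w = 0"
proof -
  have "w + i \<notin> A" if "i \<in> {0..<h}" for i
    using assms[of "w + i"] that by auto
  then show ?thesis
    unfolding window_count_def by (intro sum.neutral) auto
qed

lemma sum_of_bool_shift:
  fixes A W :: "int set"
  assumes "finite W" "(\<lambda>a. a - i) ` A \<subseteq> W"
  shows "(\<Sum>w\<in>W. of_bool (w + i \<in> A)) = real (card A)"
proof -
  have "{w \<in> W. w + i \<in> A} = (\<lambda>a. a - i) ` A"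
    using assms(2) by (auto simp: image_iff) (metis add_diff_cancel_right')
  moreover have "(\<Sum>w\<in>W. of_bool (w + i \<in> A)) = real (card {w \<in> W. w + i \<in> A})"
    using assms(1) by (simp add: sum_of_bool_eq Int_def conj_commute)
  moreover have "card ((\<lambda>a. a - i) ` A) = card A"
    by (intro card_image) (auto simp: inj_on_def)
  ultimately show ?thesis by simp
qed

text \<open>This is where thinness enters: each such \<open>w\<close> yields a distinct pair
  \<open>(w + i, w + j)\<close> of elements of \<open>A\<close> with the fixed nonzero difference
  \<open>i - j\<close>.\<close>

lemma sum_of_bool_shift2_le:
  fixes A W :: "int set"
  assumes "finite W" "thin_sidon g A" "i \<noteq> j"
  shows "(\<Sum>w\<in>W. of_bool (w + i \<in> A) * of_bool (w + j \<in> A)) \<le> real g"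
proof -
  let ?S = "{w \<in> W. w + i \<in> A \<and> w + j \<in> A}"
  let ?P = "{(a, b). a \<in> A \<and> b \<in> A \<and> a \<noteq> b \<and> a - b = i - j}"
  have P: "finite ?P" "card ?P \<le> g"
    using assms(2) unfolding thin_sidon_def by blast+
  have "card ?S \<le> card ?P"
    by (rule card_inj_on_le[of "\<lambda>w. (w + i, w + j)"]) (use P(1) assms(3) in \<open>auto simp: inj_on_def\<close>)
  moreover have "(\<Sum>w\<in>W. of_bool (w + i \<in> A) * of_bool (w + j \<in> A)) = real (card ?S)"
    using assms(1) by (simp add: sum_of_bool_eq Int_def conj_commute flip: of_bool_conj)
  ultimately show ?thesis using P(2) by simp
qed

text \<open>\<open>W\<close> holds all starting points of windows that can meet \<open>A\<close>, so
  each element is counted \<open>h\<close> times. In the expanded square the diagonal offsets give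
  \<open>card A * h\<close>, and each other pair of offsets gives at most \<open>g\<close>. The
  centre \<open>\<nu>\<close> stays free because three different values are used later.\<close>

lemma window_count_deviation_le:
  fixes A :: "int set" and h :: int and \<nu> :: real
  assumes A: "finite A" "A \<noteq> {}" "thin_sidon g A" and h: "0 \<le> h"
  defines "W \<equiv> {Min A - h<..Max A}"
  shows "(\<Sum>w\<in>W. (window_count A h w - \<nu>)\<^sup>2)
    \<le> real (card A) * h + real g * (of_int h)\<^sup>2 - 2 * \<nu> * card A * h + \<nu>\<^sup>2 * (diam A + h)"
proof -
  let ?k = "real (card A)"
  have W: "finite W" "(\<lambda>a. a - i) ` A \<subseteq> W" if "i \<in> {0..<h}" for i
  proof -
    have "Min A \<le> a" "a \<le> Max A" if "a \<in> A" for a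
      using A(1) that by auto
    with that show "(\<lambda>a. a - i) ` A \<subseteq> W" unfolding W_def by force
  qed (simp add: W_def)
  have finW: "finite W" by (simp add: W_def)
  have "Min A \<le> Max A" using A by simp
  then have cardW: "real (card W) = diam A + h"
    using h unfolding W_def diam_def by simp
  have first: "(\<Sum>w\<in>W. window_count A h w) = ?k * h"
  proof -
    have "(\<Sum>w\<in>W. window_count A h w) = (\<Sum>i\<in>{0..<h}. \<Sum>w\<in>W. of_bool (w + i \<in> A))"
      unfolding window_count_def by (rule sum.swap)
    also have "\<dots> = (\<Sum>i\<in>{0..<h}. ?k)"
      by (intro sum.cong sum_of_bool_shift refl W)
    finally show ?thesis using h by simp
  qed
  have second: "(\<Sum>w\<in>W. (window_count A h w)\<^sup>2) \<le> ?k * h + real g * (of_int h)\<^sup>2"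
  proof -
    have "(\<Sum>w\<in>W. (window_count A h w)\<^sup>2)
        = (\<Sum>w\<in>W. \<Sum>i\<in>{0..<h}. \<Sum>j\<in>{0..<h}. of_bool (w + i \<in> A) * of_bool (w + j \<in> A))"
      unfolding window_count_def power2_eq_square sum_product ..
    also have "\<dots> = (\<Sum>i\<in>{0..<h}. \<Sum>w\<in>W. \<Sum>j\<in>{0..<h}. of_bool (w + i \<in> A) * of_bool (w + j \<in> A))"
      by (rule sum.swap)
    also have "\<dots> = (\<Sum>i\<in>{0..<h}. \<Sum>j\<in>{0..<h}. \<Sum>w\<in>W. of_bool (w + i \<in> A) * of_bool (w + j \<in> A))"
      by (intro sum.cong refl sum.swap)
    also have "\<dots> \<le> (\<Sum>i\<in>{0..<h}. \<Sum>j\<in>{0..<h}. (if j = i then ?k else 0) + g)"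
    proof (intro sum_mono)
      fix i j assume i: "i \<in> {0..<h}"
      show "(\<Sum>w\<in>W. of_bool (w + i \<in> A) * of_bool (w + j \<in> A)) \<le> (if j = i then ?k else 0) + real g"
      proof (cases "j = i")
        case True
        then show ?thesis
          using sum_of_bool_shift[OF finW W(2)[OF i]] by (simp flip: of_bool_conj)
      next
        case False
        then show ?thesis
          using sum_of_bool_shift2_le[OF finW A(3), of i j] by simp
      qed
    qed
    also have "\<dots> = ?k * h + real g * (of_int h)\<^sup>2"
      using h by (simp add: sum.distrib power2_eq_square algebra_simps)
    finally show ?thesis .
  qed
  have "(\<Sum>w\<in>W. (window_count A h w - \<nu>)\<^sup>2)
      = (\<Sum>w\<in>W. (window_count A h w)\<^sup>2 - 2 * \<nu> * window_count A h w + \<nu>\<^sup>2)"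
    by (intro sum.cong refl) (simp add: power2_diff algebra_simps)
  also have "\<dots> = (\<Sum>w\<in>W. (window_count A h w)\<^sup>2) - 2 * \<nu> * (?k * h) + \<nu>\<^sup>2 * (diam A + h)"
    by (simp add: sum.distrib sum_subtractf first cardW flip: sum_distrib_left)
  finally show ?thesis using second by simp
qed

text \<open>The count of an end window cannot be close to both \<open>\<nu>\<close> and
  \<open>\<mu>\<close>. The weights are unequal because in the application the deviation for length
  \<open>2 * h\<close> is tiny, so the weight of the other one should be near 1.\<close>

lemma edge_deviation_le:
  fixes A :: "int set" and h :: int and \<mu> \<nu> :: real
  assumes A: "finite A" "A \<noteq> {}" and h: "0 \<le> h" "h \<le> diam A"
  shows "2 * h * (\<mu> - \<nu>)\<^sup>2
    \<le> 3/2 * (\<Sum>w\<in>{Min A - h<..Max A}. (window_count A h w - \<nu>)\<^sup>2)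
      + 3 * (\<Sum>w\<in>{Min A - 2 * h<..Max A}. (window_count A (2 * h) w - \<mu>)\<^sup>2)"
proof -
  let ?m = "Min A" and ?M = "Max A"
  let ?X = "window_count A h" and ?Y = "window_count A (2 * h)"
  let ?L = "{?m - h<..?m}" and ?R = "{?M - h<..?M}" and ?L' = "{?m - 2 * h<..?m - h}"
  have bounds: "?m \<le> a" "a \<le> ?M" if "a \<in> A" for a
    using A(1) that by auto
  have mM: "?m \<le> ?M - h" using h(2) unfolding diam_def by simp
  have Y: "?Y w = ?X w + ?X (w + h)" for w
    using window_count_add[of h h A w] h(1) by simp
  have XL: "?X w = ?Y (w - h)" if "w \<in> ?L" for w
  proof -
    have "?X (w - h) = 0"
      by (rule window_count_eq_0) (use bounds(1) that in force)
    then show ?thesis using Y[of "w - h"] by simp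
  qed
  have XR: "?X w = ?Y w" if "w \<in> ?R" for w
  proof -
    have "?X (w + h) = 0"
      by (rule window_count_eq_0) (use bounds(2) that in force)
    then show ?thesis using Y[of w] by simp
  qed
  \<comment> \<open>\<open>(x + y)\<^sup>2 \<le> 3/2 x\<^sup>2 + 3 y\<^sup>2\<close> with \<open>x = X - \<nu>\<close>, \<open>y = \<mu> - X\<close>\<close>
  have split_sq: "(\<mu> - \<nu>)\<^sup>2 \<le> 3/2 * (x - \<nu>)\<^sup>2 + 3 * (x - \<mu>)\<^sup>2" for x
  proof -
    have "3/2 * (x - \<nu>)\<^sup>2 + 3 * (x - \<mu>)\<^sup>2 - (\<mu> - \<nu>)\<^sup>2 = 1/2 * ((x - \<nu>) + 2 * (x - \<mu>))\<^sup>2"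
      by (simp add: power2_eq_square field_simps)
    also have "\<dots> \<ge> 0" by simp
    finally show ?thesis by simp
  qed
  \<comment> \<open>Since \<open>h \<le> diam A\<close>, the two ends do not overlap, and no window
    of either length is charged twice.\<close>
  have disj: "?L \<inter> ?R = {}" "?L' \<inter> ?R = {}" using mM h(1) by auto
  have "2 * h * (\<mu> - \<nu>)\<^sup>2 = (\<Sum>w\<in>?L \<union> ?R. (\<mu> - \<nu>)\<^sup>2)"
    using disj h(1) by (simp add: card_Un_disjoint)
  also have "\<dots> \<le> (\<Sum>w\<in>?L \<union> ?R. 3/2 * (?X w - \<nu>)\<^sup>2 + 3 * (?X w - \<mu>)\<^sup>2)"
    by (intro sum_mono split_sq)
  also have "\<dots> = 3/2 * (\<Sum>w\<in>?L \<union> ?R. (?X w - \<nu>)\<^sup>2) + 3 * (\<Sum>w\<in>?L \<union> ?R. (?X w - \<mu>)\<^sup>2)"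
    by (simp add: sum.distrib sum_distrib_left)
  also have "(\<Sum>w\<in>?L \<union> ?R. (?X w - \<mu>)\<^sup>2) = (\<Sum>w\<in>?L. (?Y (w - h) - \<mu>)\<^sup>2) + (\<Sum>w\<in>?R. (?Y w - \<mu>)\<^sup>2)"
    using disj XL XR by (simp add: sum.union_disjoint)
  also have "(\<Sum>w\<in>?L. (?Y (w - h) - \<mu>)\<^sup>2) = (\<Sum>w\<in>?L'. (?Y w - \<mu>)\<^sup>2)"
    by (rule sum.reindex_bij_witness[of _ "\<lambda>w. w + h" "\<lambda>w. w - h"]) auto
  also have "\<dots> + (\<Sum>w\<in>?R. (?Y w - \<mu>)\<^sup>2) = (\<Sum>w\<in>?L' \<union> ?R. (?Y w - \<mu>)\<^sup>2)"
    using disj by (simp add: sum.union_disjoint)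
  also have "\<dots> \<le> (\<Sum>w\<in>{?m - 2 * h<..?M}. (?Y w - \<mu>)\<^sup>2)"
    by (intro sum_mono2) (use mM h(1) in auto)
  also have "(\<Sum>w\<in>?L \<union> ?R. (?X w - \<nu>)\<^sup>2) \<le> (\<Sum>w\<in>{?m - h<..?M}. (?X w - \<nu>)\<^sup>2)"
    by (intro sum_mono2) (use mM h(1) in auto)
  finally show ?thesis by simp
qed

text \<open>If the bound failed, \<open>VX\<close> would be at most about \<open>k * t / 4\<close>
  and \<open>VY\<close> about 0, whereas the end windows force \<open>3/2 * VX + 3 * VY\<close> to
  be at least \<open>k * t / 2\<close>. The gap between 3/8 and 1/2 pays for the 1/100 and for the
  rounding.\<close>

lemma thin_sidon_diam_ge:
  fixes A :: "int set"
  assumes g: "g \<ge> 1" and A: "finite A" "thin_sidon g A" and large: "card A \<ge> 240 * g"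
  shows "(real (card A))\<^sup>2 / g - diam A \<le> (2 - 1/100) / g * (card A * sqrt (card A))"
proof (rule ccontr)
  define k where "k = real (card A)"
  define s where "s = sqrt k"
  \<comment> \<open>At diameter about \<open>k\<^sup>2 / g\<close>, a window of this length holds
    \<open>s / 2\<close> points on average. It also minimises
    \<open>G * x\<^sup>2 - k * s * x\<close> over real \<open>x\<close>.\<close>
  define H where "H = k * s / (2 * g)"
  define h where "h = \<lfloor>H\<rfloor>"
  define t where "t = real_of_int h"
  define n where "n = real_of_int (diam A)"
  define G where "G = real g"
  assume "\<not> ?thesis"
  then have "(2 - 1/100) / G * (k * s) < k\<^sup>2 / G - n"
    unfolding k_def s_def n_def G_def by simp
  moreover have G: "G \<ge> 1" using g unfolding G_def by simp
  moreover have "(2 - 1/100) / G * (k * s) = 199/50 * H"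
    using G unfolding H_def G_def by (simp add: field_simps)
  ultimately have n: "n < k\<^sup>2 / G - 199/50 * H" by linarith
  have "real (240 * g) \<le> real (card A)" using large by (simp only: of_nat_le_iff)
  then have k: "k \<ge> 240 * G" unfolding k_def G_def by simp
  have ne: "A \<noteq> {}" using large g by auto
  have ss: "s * s = k" using k G unfolding s_def by simp
  have s: "s \<ge> 4"
    unfolding s_def by (rule real_le_rsqrt) (use k G in simp)
  have HG: "2 * G * H = k * s" using G unfolding H_def G_def by simp
  have "2 * G * 1 \<le> k * s" using mult_mono[of "2 * G" k 1 s] k G s by simp
  then have "2 * G * 1 \<le> 2 * G * H" unfolding HG .
  then have "H \<ge> 1" using G by simp
  then have h: "h \<ge> 1" unfolding h_def by simp
  then have t: "t \<ge> 1" "t \<le> H" "H - t \<le> 1" unfolding t_def h_def by linarith+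
  have k0: "k > 0" using k G by simp
  have kG: "k * (k\<^sup>2 / G) = 4 * G * H\<^sup>2"
  proof -
    have "G * (4 * G * H\<^sup>2) = (k * s)\<^sup>2"
      unfolding HG[symmetric] by (simp add: power2_eq_square)
    also have "\<dots> = k\<^sup>2 * (s * s)" by (simp add: power2_eq_square)
    also have "\<dots> = k * k\<^sup>2" unfolding ss by simp
    finally show ?thesis using G by (simp add: field_simps)
  qed
  \<comment> \<open>Completing the square at the minimiser \<open>H\<close> shows that rounding down
    to an integer length costs at most \<open>G\<close>.\<close>
  have "(H - t)\<^sup>2 \<le> 1" using t by (simp add: power_le_one)
  then have "G * (H - t)\<^sup>2 \<le> G" using G by simp
  moreover have "G * (H - t)\<^sup>2 = G * t\<^sup>2 - k * s * t + G * H\<^sup>2"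
    unfolding HG[symmetric] by (simp add: power2_eq_square algebra_simps)
  ultimately have round: "G * t\<^sup>2 - k * s * t + G * H\<^sup>2 \<le> G" by simp
  have kn: "k * n \<le> 4 * (G * H\<^sup>2) - 199/50 * (k * t)"
  proof -
    have "k * n \<le> k * (k\<^sup>2 / G - 199/50 * H)" using n k0 by simp
    also have "\<dots> = 4 * (G * H\<^sup>2) - 199/50 * (k * H)" using kG by (simp add: algebra_simps)
    finally have "k * n \<le> 4 * (G * H\<^sup>2) - 199/50 * (k * H)" .
    moreover have "k * t \<le> k * H" using t k0 by simp
    ultimately show ?thesis by simp
  qed
  have dev: "(\<Sum>w\<in>{Min A - l<..Max A}. (window_count A l w - \<nu>)\<^sup>2)
      \<le> k * l + G * l\<^sup>2 - 2 * \<nu> * k * l + \<nu>\<^sup>2 * (n + l)" if "0 \<le> l" for l \<nu>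
    using window_count_deviation_le[OF A(1) ne A(2) that, of \<nu>] unfolding k_def n_def G_def by simp
  define VX where "VX = (\<Sum>w\<in>{Min A - h<..Max A}. (window_count A h w - s / 2)\<^sup>2)"
  define VY where "VY = (\<Sum>w\<in>{Min A - 2 * h<..Max A}. (window_count A (2 * h) w - s)\<^sup>2)"
  have "VX \<le> k * t + G * t\<^sup>2 - 2 * (s / 2) * k * t + (s / 2)\<^sup>2 * (n + t)"
    using dev[of h "s / 2"] h unfolding VX_def t_def by simp
  also have "\<dots> = k * t + G * t\<^sup>2 - k * s * t + (s * s * n + s * s * t) / 4"
    by (simp add: power2_eq_square field_simps)
  \<comment> \<open>The quadratic terms cancel through \<open>round\<close>; the coefficient is 1 +
    1/4 - 199/200.\<close>
  finally have VX: "VX \<le> 51/200 * (k * t) + G"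
    using kn round unfolding ss by argo
  have "VY \<le> k * (2 * t) + G * (2 * t)\<^sup>2 - 2 * s * k * (2 * t) + s\<^sup>2 * (n + 2 * t)"
    using dev[of "2 * h" s] h unfolding VY_def t_def by simp
  also have "\<dots> = 2 * (k * t) + 4 * (G * t\<^sup>2) - 4 * (k * s * t) + (s * s * n + 2 * (s * s * t))"
    by (simp add: power2_eq_square algebra_simps)
  \<comment> \<open>The same cancellation, four times over, leaves 2 + 2 - 199/50.\<close>
  finally have VY: "VY \<le> 1/50 * (k * t) + 4 * G"
    using kn round unfolding ss by argo
  have hn: "h \<le> diam A"
  proof (rule ccontr)
    assume "\<not> h \<le> diam A"
    then have nh: "n \<le> t" unfolding n_def t_def by simp
    \<comment> \<open>If \<open>n \<le> t\<close>, at most \<open>2 * t\<close> windows share the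
      total count \<open>k * t\<close>, so the mean is at least \<open>k / 2\<close>. With that
      centre the second moment bound becomes negative.\<close>
    have "0 \<le> k * t + G * t\<^sup>2 - k * k * t + k\<^sup>2 / 4 * (n + t)"
    proof -
      have "0 \<le> (\<Sum>w\<in>{Min A - h<..Max A}. (window_count A h w - k / 2)\<^sup>2)"
        by (intro sum_nonneg) simp
      also have "\<dots> \<le> k * t + G * t\<^sup>2 - 2 * (k / 2) * k * t + (k / 2)\<^sup>2 * (n + t)"
        using dev[of h "k / 2"] h unfolding t_def by simp
      finally show ?thesis by (simp add: power_divide)
    qed
    also have "\<dots> \<le> k * t + G * t\<^sup>2 - k * k * t + k\<^sup>2 / 4 * (2 * t)"
      using nh by (intro add_left_mono mult_left_mono) auto
    also have "\<dots> = t * (k + G * t - k\<^sup>2 / 2)"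
      by (simp add: power2_eq_square algebra_simps)
    also have "\<dots> < 0"
    proof (rule mult_pos_neg)
      have "G * t \<le> G * H" using t G by simp
      also have "\<dots> = k * s / 2" using HG by simp
      finally have "k + G * t - k\<^sup>2 / 2 \<le> k * (1 + s / 2 - s * s / 2)"
        unfolding ss by (simp add: power2_eq_square field_simps)
      moreover have "4 * s \<le> s * s" using s by simp
      then have "1 + s / 2 - s * s / 2 < 0" using s by linarith
      then have "k * (1 + s / 2 - s * s / 2) < 0"
        using k0 by (intro mult_pos_neg)
      ultimately show "k + G * t - k\<^sup>2 / 2 < 0" by (rule le_less_trans)
    qed (use t in simp)
    finally show False by simp
  qed
  have "2 * t * (s - s / 2)\<^sup>2 \<le> 3/2 * VX + 3 * VY"
    unfolding VX_def VY_def t_def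
    using edge_deviation_le[OF A(1) ne _ hn, of s "s / 2"] h by simp
  moreover have "2 * t * (s - s / 2)\<^sup>2 = k * t / 2"
    unfolding ss[symmetric] by (simp add: power2_eq_square algebra_simps)
  ultimately have "23/400 * (k * t) \<le> 27/2 * G"
    using VX VY by linarith
  \<comment> \<open>The threshold 240 is large enough because 240 * 23/400 = 13.8 exceeds
    27/2.\<close>
  moreover have "240 * G * 1 \<le> k * t" using k G t by (intro mult_mono) auto
  ultimately show False using G by simp
qed

theorem theorem5:
  fixes g :: nat
  assumes "g \<ge> 1"
  shows "\<exists>\<epsilon>::real. \<epsilon> > 0 \<and> b_inf g \<le> ereal ((2 - \<epsilon>) / real g)"
proof (intro exI conjI)
  \<comment> \<open>One value 1/100 serves every \<open>g\<close>; only the threshold on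
    \<open>k\<close> depends on \<open>g\<close>.\<close>
  show "b_inf g \<le> ereal ((2 - 1/100) / real g)"
    unfolding b_inf_def
  proof (rule Limsup_bounded, rule eventually_sequentiallyI)
    fix k assume k: "240 * g \<le> k"
    let ?A = "opt_thin_sidon g k"
    have k0: "k \<ge> 1" using k assms by simp
    have A: "finite ?A" "card ?A = k" "thin_sidon g ?A"
      using opt_thin_sidon_is_arg_min[OF assms k0] unfolding is_arg_min_def by auto
    have "real k powr (3/2) = real k powr (1 + 1/2)" by simp
    also have "\<dots> = real k * sqrt (real k)"
      unfolding powr_add using k0 by (simp add: powr_half_sqrt)
    finally have "(real k)\<^sup>2 / g - diam ?A \<le> (2 - 1/100) / g * (real k powr (3/2))"
      using thin_sidon_diam_ge[OF assms A(1,3)] k A(2) by simp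
    then show "ereal (((real k)\<^sup>2 / real g - real_of_int (diam ?A)) / real k powr (3/2))
        \<le> ereal ((2 - 1/100) / real g)"
      using k0 by (simp add: pos_divide_le_eq)
  qed
qed simp

end
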